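(* Let $k\ge 1$ be an integer and let $G$ be a finite simple graph that is claw-free and minimal $k$-factor-critical. If $G$ is $(k+1)$-connected, then $G$ has at least $\frac{k-1}{2k}|V(G)|$ vertices of degree $k+1$.
   Context: A graph $G$ of order $n$ is $k$-factor-critical (for an integer $1\le k<n$) if for every set $X$ of $k$ vertices, $G-X$ has a perfect matching. A $k$-factor-critical graph $G$ is minimal if for every edge $e$ of $G$, the graph $G-e$ is not $k$-factor-critical. A graph is claw-free if it has no induced subgraph isomorphic to $K_{1,3}$. *)

theory Defs
  imports Complex_Main
begin

text \<open>
  A graph is given by its vertex set \<open>V\<close> and its edge set \<open>E\<close>, where an edge is an unordered pair
  of distinct vertices.
\<close>

definition simple_graph :: "'a set \<Rightarrow> 'a set set \<Rightarrow> bool" where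
  "simple_graph V E \<longleftrightarrow> finite V \<and> (\<forall>e\<in>E. e \<subseteq> V \<and> card e = 2)"

definition degree :: "'a set set \<Rightarrow> 'a \<Rightarrow> nat" where
  "degree E v = card {e \<in> E. v \<in> e}"

text \<open>
  The subgraph induced by \<open>W\<close> is \<open>(W, induced_edges E W)\<close>; in particular \<open>G - X\<close> is
  \<open>(V - X, induced_edges E (V - X))\<close>.
\<close>

definition induced_edges :: "'a set set \<Rightarrow> 'a set \<Rightarrow> 'a set set" where
  "induced_edges E W = {e \<in> E. e \<subseteq> W}"

definition graph_isomorphic :: "'a set \<Rightarrow> 'a set set \<Rightarrow> 'b set \<Rightarrow> 'b set set \<Rightarrow> bool" where
  "graph_isomorphic V E V' E' \<longleftrightarrow>
     (\<exists>f. bij_betw f V V' \<and> (\<forall>u\<in>V. \<forall>v\<in>V. {u, v} \<in> E \<longleftrightarrow> {f u, f v} \<in> E'))"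

definition claw_verts :: "nat set" where
  "claw_verts = {0, 1, 2, 3}"

definition claw_edges :: "nat set set" where
  "claw_edges = {{0, 1}, {0, 2}, {0, 3}}"

definition claw_free :: "'a set \<Rightarrow> 'a set set \<Rightarrow> bool" where
  "claw_free V E \<longleftrightarrow>
     \<not> (\<exists>W\<subseteq>V. graph_isomorphic W (induced_edges E W) claw_verts claw_edges)"

definition matching :: "'a set set \<Rightarrow> 'a set set \<Rightarrow> bool" where
  "matching E M \<longleftrightarrow> M \<subseteq> E \<and> pairwise disjnt M"

definition perfect_matching :: "'a set \<Rightarrow> 'a set set \<Rightarrow> 'a set set \<Rightarrow> bool" where
  "perfect_matching V E M \<longleftrightarrow> matching E M \<and> \<Union>M = V"

definition factor_critical :: "nat \<Rightarrow> 'a set \<Rightarrow> 'a set set \<Rightarrow> bool" where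
  "factor_critical k V E \<longleftrightarrow> 1 \<le> k \<and> k < card V \<and>
     (\<forall>X\<subseteq>V. card X = k \<longrightarrow> (\<exists>M. perfect_matching (V - X) (induced_edges E (V - X)) M))"

definition minimal_factor_critical :: "nat \<Rightarrow> 'a set \<Rightarrow> 'a set set \<Rightarrow> bool" where
  "minimal_factor_critical k V E \<longleftrightarrow>
     factor_critical k V E \<and> (\<forall>e\<in>E. \<not> factor_critical k V (E - {e}))"

definition graph_connected :: "'a set \<Rightarrow> 'a set set \<Rightarrow> bool" where
  "graph_connected V E \<longleftrightarrow> V \<noteq> {} \<and> (\<forall>u\<in>V. \<forall>v\<in>V. (u, v) \<in> {(x, y). {x, y} \<in> E}\<^sup>*)"

text \<open>
  The usual convention for complete graphs: the complete graph on \<open>n\<close> vertices is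
  \<open>k\<close>-connected exactly for \<open>k < n\<close>.
\<close>

definition k_connected :: "nat \<Rightarrow> 'a set \<Rightarrow> 'a set set \<Rightarrow> bool" where
  "k_connected k V E \<longleftrightarrow> k < card V \<and>
     (\<forall>X\<subseteq>V. card X < k \<longrightarrow> graph_connected (V - X) (induced_edges E (V - X)))"

end

theory Submission
  imports Defs
begin

text \<open>
  Call a vertex big if its degree is at least \<open>k + 2\<close>, and let \<open>k \<ge> 2\<close>. For an edge \<open>uv\<close>, minimality
  and Tutte's theorem give a set \<open>S\<close> such that \<open>G - uv - S\<close> has \<open>|S| - k + 2\<close> odd parts, two of which
  are joined by \<open>uv\<close>. As \<open>G\<close> is claw-free and \<open>(k + 1)\<close>-connected, counting adjacencies between \<open>S\<close>
  and these parts forces \<open>|S| \<le> k + 1\<close>. If \<open>|S| = k\<close>, then \<open>uv\<close> is a bridge of \<open>G - S\<close>; if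
  \<open>|S| = k + 1\<close> and \<open>u\<close>, \<open>v\<close> are big, then \<open>u\<close> and \<open>v\<close> have the same closed neighbourhood.
  An uncrossing argument in the style of Mader shows that three big vertices never form a triangle.
  Claw-freeness then leaves every big vertex at most two big neighbours, hence at least \<open>k\<close>
  neighbours of degree \<open>k + 1\<close>, and double counting finishes the proof.
\<close>

section \<open>The theorems of Hall and Tutte\<close>

text \<open>This is the induction of Halmos and Vaughan. If a nonempty proper subfamily
  \<open>J\<close> is tight, it is solved on its own, and the rest is solved after removing the
  elements available to \<open>J\<close>. If none is tight, every nonempty proper subfamily has an
  element to spare, so any choice for one index can be fixed.\<close>

theorem hall:
  assumes "finite I" "\<And>i. i \<in> I \<Longrightarrow> finite (A i)"
    and "\<And>J. J \<subseteq> I \<Longrightarrow> card J \<le> card (\<Union>(A ` J))"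
  shows "\<exists>R. inj_on R I \<and> (\<forall>i\<in>I. R i \<in> A i)"
  using assms
proof (induction "card I" arbitrary: I A rule: less_induct)
  case less
  note fin = \<open>finite I\<close> and finA = less.prems(2) and cond = less.prems(3)
  consider "I = {}"
    | J where "J \<subseteq> I" "J \<noteq> {}" "J \<noteq> I" "card (\<Union>(A ` J)) = card J"
    | "I \<noteq> {}" "\<And>J. J \<subseteq> I \<Longrightarrow> J \<noteq> {} \<Longrightarrow> J \<noteq> I \<Longrightarrow> card J < card (\<Union>(A ` J))"
    using cond by (metis le_neq_implies_less)
  then show ?case
  proof cases
    case 1
    then show ?thesis by auto
  next
    case (2 J)
    let ?U = "\<Union>(A ` J)"
    have finJ: "finite J"
      using 2(1) fin by (rule finite_subset)
    have "card J < card I"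
      using 2(1,3) fin by (meson psubsetI psubset_card_mono)
    then have "\<exists>R. inj_on R J \<and> (\<forall>i\<in>J. R i \<in> A i)"
      using finJ finA cond 2(1) by (intro less.hyps) auto
    then obtain R1 where R1: "inj_on R1 J" "\<forall>i\<in>J. R1 i \<in> A i"
      by blast
    have "card (I - J) < card I"
      using 2(1,2) fin by (metis Diff_disjoint Int_absorb1 double_diff order_refl
          psubsetI psubset_card_mono Diff_subset)
    \<comment> \<open>This is Hall's condition for \<open>K \<union> J\<close>, less the equality
      that holds for \<open>J\<close>.\<close>
    moreover have "card K \<le> card (\<Union>i\<in>K. A i - ?U)" if K: "K \<subseteq> I - J" for K
    proof -
      have finK: "finite K" using K fin finite_subset by blast
      have "card K + card J = card (K \<union> J)"
        using K finK finJ by (subst card_Un_disjoint) auto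
      also have "\<dots> \<le> card (\<Union>(A ` (K \<union> J)))"
        using K 2(1) by (intro cond) auto
      also have "\<Union>(A ` (K \<union> J)) = (\<Union>i\<in>K. A i - ?U) \<union> ?U"
        by auto
      also have "card \<dots> \<le> card (\<Union>i\<in>K. A i - ?U) + card J"
        using card_Un_le 2(4) by metis
      finally show ?thesis by simp
    qed
    ultimately obtain R2 where R2: "inj_on R2 (I - J)" "\<forall>i\<in>I - J. R2 i \<in> A i - ?U"
      using less.hyps[of "I - J" "\<lambda>i. A i - ?U"] fin finA by auto
    have "inj_on (\<lambda>i. if i \<in> J then R1 i else R2 i) I"
      using R1 R2 unfolding inj_on_def by (smt (verit) DiffE DiffI UN_I)
    moreover have "\<forall>i\<in>I. (if i \<in> J then R1 i else R2 i) \<in> A i"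
      using R1 R2 by auto
    ultimately show ?thesis by blast
  next
    case 3
    then obtain i where i: "i \<in> I" by auto
    then have "A i \<noteq> {}" using cond[of "{i}"] by auto
    then obtain x where x: "x \<in> A i" by auto
    have "card K \<le> card (\<Union>j\<in>K. A j - {x})" if K: "K \<subseteq> I - {i}" for K
    proof (cases "K = {}")
      case False
      have "finite (\<Union>(A ` K))"
        using K fin finA by (auto intro: finite_subset)
      then have "card (\<Union>(A ` K)) \<le> Suc (card (\<Union>(A ` K) - {x}))"
        using card_Diff1_le[of "\<Union>(A ` K)" x] card_Suc_Diff1[of "\<Union>(A ` K)" x]
        by (cases "x \<in> \<Union>(A ` K)") (simp_all del: Union_iff UN_iff)
      moreover have "card K < card (\<Union>(A ` K))"
        using False K i by (intro 3(2)) auto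
      moreover have "\<Union>(A ` K) - {x} = (\<Union>j\<in>K. A j - {x})"
        by auto
      ultimately show ?thesis by (metis less_Suc_eq_le order_less_le_trans)
    qed simp
    moreover have "card (I - {i}) < card I"
      using i fin by (metis card_Diff1_less)
    ultimately obtain R where R: "inj_on R (I - {i})" "\<forall>j\<in>I - {i}. R j \<in> A j - {x}"
      using less.hyps[of "I - {i}" "\<lambda>j. A j - {x}"] fin finA by auto
    have "inj_on (R(i := x)) I"
      using R unfolding inj_on_def by auto
    moreover have "\<forall>j\<in>I. (R(i := x)) j \<in> A j"
      using R x by auto
    ultimately show ?thesis by blast
  qed
qed

text \<open>
  The members of \<open>\<C>\<close> are unions of components of \<open>G[W] - S\<close> rather than single components.
  Tutte's theorem holds in this form as well, and connectedness never enters its proof.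
\<close>

definition odd_family :: "'a set set \<Rightarrow> 'a set \<Rightarrow> 'a set \<Rightarrow> 'a set set \<Rightarrow> bool" where
  "odd_family E W S \<C> \<longleftrightarrow> S \<subseteq> W \<and> pairwise disjnt \<C> \<and>
     (\<forall>C\<in>\<C>. C \<subseteq> W - S \<and> odd (card C) \<and> (\<forall>x\<in>C. \<forall>y\<in>W. {x, y} \<in> E \<longrightarrow> y \<in> C \<union> S))"

section \<open>Parity of odd families and the easy half of Tutte's theorem\<close>

lemma odd_familyD:
  assumes "odd_family E W S \<C>"
  shows "S \<subseteq> W" "pairwise disjnt \<C>"
    and "\<And>C. C \<in> \<C> \<Longrightarrow> C \<subseteq> W - S"
    and "\<And>C. C \<in> \<C> \<Longrightarrow> odd (card C)"
    and "\<And>C. C \<in> \<C> \<Longrightarrow> C \<noteq> {}"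
    and "\<And>C x y. C \<in> \<C> \<Longrightarrow> x \<in> C \<Longrightarrow> y \<in> W \<Longrightarrow> {x, y} \<in> E \<Longrightarrow> y \<in> C \<union> S"
    and "\<And>C D x. C \<in> \<C> \<Longrightarrow> D \<in> \<C> \<Longrightarrow> x \<in> C \<Longrightarrow> x \<in> D \<Longrightarrow> C = D"
  using assms unfolding odd_family_def pairwise_def disjnt_def by auto

lemma odd_family_finite:
  assumes "odd_family E W S \<C>" "finite W"
  shows "finite \<C>"
proof (rule finite_subset)
  show "\<C> \<subseteq> Pow W" using odd_familyD(3)[OF assms(1)] by auto
qed (use assms in simp)

lemma odd_family_parity:
  assumes fam: "odd_family E W S \<C>" and "finite W"
  shows "even (card W) \<longleftrightarrow> even (card S + card \<C> + card (W - S - \<Union>\<C>))"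
proof -
  note F = odd_familyD[OF fam]
  have finC: "finite \<C>" using odd_family_finite assms by blast
  have fin: "finite C" if "C \<in> \<C>" for C
    using F(3)[OF that] \<open>finite W\<close> finite_subset by blast
  have "card W = card S + card (W - S)"
    using F(1) \<open>finite W\<close> by (metis card_Diff_subset card_mono finite_subset le_add_diff_inverse)
  also have "card (W - S) = card (\<Union>\<C>) + card (W - S - \<Union>\<C>)"
    using F(3) \<open>finite W\<close>
    by (metis Union_least card_Diff_subset card_mono finite_Diff finite_subset le_add_diff_inverse)
  finally have "card W = card S + card (\<Union>\<C>) + card (W - S - \<Union>\<C>)" by simp
  moreover have "even (card (\<Union>\<C>)) \<longleftrightarrow> even (card \<C>)"
  proof -
    have "{C \<in> \<C>. odd (card C)} = \<C>" using F(4) by auto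
    then show ?thesis
      using card_Union_disjoint[OF F(2)] fin even_sum_iff[OF finC, of card] by simp
  qed
  ultimately show ?thesis by simp
qed

lemma odd_family_remainder_closed:
  assumes fam: "odd_family E W S \<C>"
    and "x \<in> W - S - \<Union>\<C>" "y \<in> W" "{x, y} \<in> E"
  shows "y \<in> (W - S - \<Union>\<C>) \<union> S"
proof (rule ccontr)
  assume "\<not> ?thesis"
  then obtain C where "C \<in> \<C>" "y \<in> C" using \<open>y \<in> W\<close> by auto
  then have "x \<in> C \<union> S"
    using odd_familyD(6)[OF fam, of C y x] assms by (auto simp: insert_commute)
  then show False using assms \<open>C \<in> \<C>\<close> by auto
qed

lemma odd_family_insert_remainder:
  assumes fam: "odd_family E W S \<C>" and odd: "odd (card (W - S - \<Union>\<C>))" and "finite W"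
  shows "odd_family E W S (insert (W - S - \<Union>\<C>) \<C>)"
    and "card (insert (W - S - \<Union>\<C>) \<C>) = Suc (card \<C>)"
proof -
  let ?R = "W - S - \<Union>\<C>"
  have "?R \<noteq> {}" using odd by (metis card.empty even_zero)
  then have "?R \<notin> \<C>" by blast
  then show "card (insert ?R \<C>) = Suc (card \<C>)"
    using odd_family_finite[OF fam \<open>finite W\<close>] by simp
  have "pairwise disjnt (insert ?R \<C>)"
    using odd_familyD(2)[OF fam] by (auto simp: pairwise_insert disjnt_def)
  then show "odd_family E W S (insert ?R \<C>)"
    using fam odd odd_family_remainder_closed[OF fam] unfolding odd_family_def by blast
qed

text \<open>With \<open>card W\<close> even, a surplus of exactly one leaves an odd number of
  uncovered vertices, and these form one more member. The surplus of two pays for the vertex deleted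
  in the proof of Tutte's theorem, and later it shows that the ends of a deleted edge lie in
  different odd sets.\<close>

lemma odd_family_excess_2:
  assumes "odd_family E W S \<C>" "finite W" "even (card W)" "card S < card \<C>"
  obtains \<D> where "odd_family E W S \<D>" "card S + 2 \<le> card \<D>"
proof (cases "card \<C> = card S + 1")
  case True
  then have "odd (card (W - S - \<Union>\<C>))"
    using odd_family_parity[OF assms(1,2)] assms(3) by simp
  then show ?thesis
    using odd_family_insert_remainder[OF assms(1) _ assms(2)] True that by fastforce
next
  case False
  then show ?thesis using assms that by simp
qed

text \<open>An odd set cannot be matched within itself, so the matching joins each member to a
  vertex of \<open>S\<close>. Disjointness of the matching edges makes these vertices
  distinct.\<close>

lemma perfect_matching_odd_family:
  assumes pm: "perfect_matching W (induced_edges E W) M"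
    and fam: "odd_family E W S \<C>" and "finite W" and E2: "\<And>e. e \<in> E \<Longrightarrow> card e = 2"
  shows "card \<C> \<le> card S"
proof -
  note F = odd_familyD[OF fam]
  have M: "\<And>e. e \<in> M \<Longrightarrow> e \<in> E \<and> e \<subseteq> W" "pairwise disjnt M" "\<Union>M = W"
    using pm unfolding perfect_matching_def matching_def induced_edges_def by auto
  have "\<exists>s\<in>S. \<exists>x\<in>C. {x, s} \<in> M" if C: "C \<in> \<C>" for C
  proof (rule ccontr)
    assume no: "\<not> ?thesis"
    have sub: "e \<subseteq> C" if e: "e \<in> M" "x \<in> e" "x \<in> C" for e x
    proof -
      have "card e = 2" using e M E2 by blast
      then obtain y where y: "e = {x, y}"
        using \<open>x \<in> e\<close> by (metis card_2_iff insert_iff insert_commute singletonD)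
      then have "y \<in> C \<union> S" using F(6)[OF C \<open>x \<in> C\<close>, of y] e M(1) by auto
      then show ?thesis using no y e by blast
    qed
    let ?M = "{e \<in> M. e \<subseteq> C}"
    have "\<Union>?M = C" using sub M(3) F(3)[OF C] by blast
    moreover have "card (\<Union>?M) = sum card ?M"
      using M(1) \<open>finite W\<close> pairwise_subset[OF M(2)]
      by (intro card_Union_disjoint) (auto intro: finite_subset)
    moreover have "sum card ?M = sum (\<lambda>_. 2) ?M"
      using M(1) E2 by (intro sum.cong) auto
    ultimately have "even (card C)" by simp
    then show False using F(4)[OF C] by simp
  qed
  then obtain s where s: "\<And>C. C \<in> \<C> \<Longrightarrow> s C \<in> S \<and> (\<exists>x\<in>C. {x, s C} \<in> M)"
    by metis
  have "inj_on s \<C>"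
  proof (rule inj_onI)
    fix C D assume CD: "C \<in> \<C>" "D \<in> \<C>" "s C = s D"
    obtain x where x: "x \<in> C" "{x, s C} \<in> M" using s CD by blast
    obtain y where y: "y \<in> D" "{y, s C} \<in> M" using s CD by metis
    have "\<not> disjnt {x, s C} {y, s C}" by (auto simp: disjnt_def)
    then have "{x, s C} = {y, s C}"
      using M(2) x(2) y(2) unfolding pairwise_def by metis
    then have "x = y" by (metis doubleton_eq_iff)
    then show "C = D" using F(7) x y CD by blast
  qed
  then show ?thesis
    using s F(1) \<open>finite W\<close> by (metis card_inj_on_le finite_subset image_subsetI)
qed

lemma perfect_matching_Union:
  assumes "finite I"
    and "\<And>i. i \<in> I \<Longrightarrow> perfect_matching (P i) (induced_edges E (P i)) (M i)"
    and "\<And>i j. i \<in> I \<Longrightarrow> j \<in> I \<Longrightarrow> i \<noteq> j \<Longrightarrow> P i \<inter> P j = {}"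
  shows "perfect_matching (\<Union>i\<in>I. P i) (induced_edges E (\<Union>i\<in>I. P i)) (\<Union>i\<in>I. M i)"
proof -
  have M: "\<And>i e. i \<in> I \<Longrightarrow> e \<in> M i \<Longrightarrow> e \<in> E \<and> e \<subseteq> P i"
    "\<And>i. i \<in> I \<Longrightarrow> pairwise disjnt (M i)" "\<And>i. i \<in> I \<Longrightarrow> \<Union>(M i) = P i"
    using assms(2) unfolding perfect_matching_def matching_def induced_edges_def by blast+
  have "disjnt e f" if ef: "i \<in> I" "j \<in> I" "e \<in> M i" "f \<in> M j" "e \<noteq> f" for i j e f
  proof (cases "i = j")
    case True
    then show ?thesis using M(2)[of i] ef unfolding pairwise_def by auto
  next
    case False
    then show ?thesis using M(1) assms(3) ef unfolding disjnt_def by blast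
  qed
  then have "pairwise disjnt (\<Union>i\<in>I. M i)" unfolding pairwise_def by auto
  moreover have "(\<Union>i\<in>I. M i) \<subseteq> induced_edges E (\<Union>i\<in>I. P i)"
    using M(1) unfolding induced_edges_def by blast
  moreover have "\<Union>(\<Union>i\<in>I. M i) = (\<Union>i\<in>I. P i)" using M(3) by blast
  ultimately show ?thesis unfolding perfect_matching_def matching_def by simp
qed

text \<open>
  Anderson's proof: for a maximal \<open>S\<close> attaining equality, Hall's theorem matches \<open>S\<close> with the odd
  sets, and each of these sets satisfies the hypothesis after the removal of any one vertex.
\<close>

theorem tutte:
  assumes "finite W" "even (card W)"
    and "\<And>S \<C>. odd_family E W S \<C> \<Longrightarrow> card \<C> \<le> card S"
  shows "\<exists>M. perfect_matching W (induced_edges E W) M"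
  using assms
proof (induction "card W" arbitrary: W rule: less_induct)
  case less
  note fin = less.prems(1) and ev = less.prems(2) and cond = less.prems(3)
  \<comment> \<open>\<open>P S\<close> says that \<open>S\<close> is tight. The empty set is tight
    through the empty family, so a largest tight set exists.\<close>
  define P where "P S \<longleftrightarrow> (\<exists>\<C>. odd_family E W S \<C> \<and> card \<C> = card S)" for S
  have "P {}" unfolding P_def odd_family_def by (intro exI[of _ "{}"]) auto
  moreover have "card S \<le> card W" if "P S" for S
    using that fin unfolding P_def by (meson card_mono odd_familyD(1))
  ultimately have "\<exists>S. P S \<and> (\<forall>T. P T \<longrightarrow> card T \<le> card S)"
    by (intro ex_has_greatest_nat[of P "{}" card "Suc (card W)"]) (auto simp: le_imp_less_Suc)
  then obtain S where S: "P S" and max: "\<And>T. P T \<Longrightarrow> card T \<le> card S"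
    by blast
  obtain \<C> where fam: "odd_family E W S \<C>" and eq: "card \<C> = card S"
    using S unfolding P_def by blast
  note F = odd_familyD[OF fam]
  have finC: "finite \<C>" using odd_family_finite fam fin by blast
  have finS: "finite S" using F(1) fin finite_subset by blast
  let ?R = "W - S - \<Union>\<C>"
  \<comment> \<open>The remainder has even size. If it were nonempty, moving one of its vertices
    into \<open>S\<close> would leave an odd set and produce a larger tight set.\<close>
  have R: "?R = {}"
  proof (rule ccontr)
    assume "?R \<noteq> {}"
    then obtain v where v: "v \<in> ?R" by blast
    have "even (card ?R)" using odd_family_parity[OF fam fin] ev eq by simp
    moreover have "Suc (card (?R - {v})) = card ?R"
      using v fin by (intro card_Suc_Diff1) auto
    ultimately have odd: "odd (card (?R - {v}))"
      by (metis even_Suc)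
    have "?R - {v} \<noteq> {}" using odd by (metis card.empty even_zero)
    then have notin: "?R - {v} \<notin> \<C>" by blast
    have "pairwise disjnt (insert (?R - {v}) \<C>)"
      using F(2) by (auto simp: pairwise_insert disjnt_def)
    moreover have "\<forall>C\<in>\<C>. C \<subseteq> W - insert v S \<and> odd (card C) \<and>
        (\<forall>x\<in>C. \<forall>y\<in>W. {x, y} \<in> E \<longrightarrow> y \<in> C \<union> insert v S)"
      using F(3,4,6) v by blast
    moreover have "\<forall>x\<in>?R - {v}. \<forall>y\<in>W. {x, y} \<in> E \<longrightarrow> y \<in> (?R - {v}) \<union> insert v S"
      using odd_family_remainder_closed[OF fam] by blast
    ultimately have "odd_family E W (insert v S) (insert (?R - {v}) \<C>)"
      using odd v F(1) unfolding odd_family_def by auto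
    then have "P (insert v S)"
      unfolding P_def using notin finC finS v eq by (intro exI conjI) auto
    then show False using max[of "insert v S"] v finS by simp
  qed
  have pmC: "\<exists>M. perfect_matching (C - {v}) (induced_edges E (C - {v})) M"
    if C: "C \<in> \<C>" and v: "v \<in> C" for C v
  proof (rule less.hyps)
    have CW: "C \<subseteq> W - S" and finCC: "finite C" using F(3)[OF C] fin finite_subset by blast+
    show "finite (C - {v})" using finCC by simp
    show "card (C - {v}) < card W"
      using v CW fin by (intro psubset_card_mono) auto
    have "Suc (card (C - {v})) = card C" using v finCC by (metis card_Suc_Diff1)
    then show evC: "even (card (C - {v}))" using F(4)[OF C] by (metis even_Suc)
    fix T \<D> assume D: "odd_family E (C - {v}) T \<D>"
    show "card \<D> \<le> card T"
    proof (rule ccontr)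
      assume "\<not> card \<D> \<le> card T"
      then obtain \<D>' where D': "odd_family E (C - {v}) T \<D>'" and card: "card T + 2 \<le> card \<D>'"
        using odd_family_excess_2[OF D] \<open>finite (C - {v})\<close> evC by (metis not_le)
      note G = odd_familyD[OF D']
      \<comment> \<open>Replacing \<open>C\<close> by \<open>\<D>'\<close> loses one member and
        gains at least \<open>card T + 2\<close>, while \<open>S\<close> grows by
        \<open>card T + 1\<close>. The result would be a tight set larger than
        \<open>S\<close>.\<close>
      let ?S = "insert v (S \<union> T)" and ?\<C> = "(\<C> - {C}) \<union> \<D>'"
      have "finite \<D>'" using odd_family_finite D' \<open>finite (C - {v})\<close> by blast
      have "pairwise disjnt ?\<C>"
        using F(2,7) G(2,3,7) C unfolding pairwise_def disjnt_def
        by (smt (verit, best) Diff_iff Un_iff disjoint_iff insertCI subsetD)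
      moreover have "D \<subseteq> W - ?S \<and> odd (card D) \<and>
          (\<forall>x\<in>D. \<forall>y\<in>W. {x, y} \<in> E \<longrightarrow> y \<in> D \<union> ?S)" if "D \<in> \<D>'" for D
      proof (intro conjI ballI impI)
        show "D \<subseteq> W - ?S" using G(3)[OF that] CW by auto
        show "odd (card D)" using G(4)[OF that] .
        fix x y assume xy: "x \<in> D" "y \<in> W" "{x, y} \<in> E"
        then have "y \<in> C \<union> S" using F(6)[OF C] G(3)[OF that] by blast
        then show "y \<in> D \<union> ?S" using G(6)[OF that, of x y] xy by auto
      qed
      moreover have "C' \<subseteq> W - ?S \<and> odd (card C') \<and>
          (\<forall>x\<in>C'. \<forall>y\<in>W. {x, y} \<in> E \<longrightarrow> y \<in> C' \<union> ?S)" if "C' \<in> \<C> - {C}" for C'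
      proof -
        have "C' \<inter> C = {}" using F(7) C that by blast
        then have "C' \<subseteq> W - ?S" using F(3)[of C'] that G(1) v by auto
        moreover have "y \<in> C' \<union> ?S" if "x \<in> C'" "y \<in> W" "{x, y} \<in> E" for x y
          using F(6)[of C' x y] that \<open>C' \<in> \<C> - {C}\<close> by auto
        ultimately show ?thesis using F(4)[of C'] that by auto
      qed
      moreover have "?S \<subseteq> W" using F(1) G(1) CW v by auto
      ultimately have fam': "odd_family E W ?S ?\<C>"
        unfolding odd_family_def by (metis UnE)
      have "(\<C> - {C}) \<inter> \<D>' = {}"
      proof (rule ccontr)
        assume "\<not> ?thesis"
        then obtain D where D: "D \<in> \<C>" "D \<noteq> C" "D \<in> \<D>'" by blast
        then show False using G(3,5)[of D] F(7)[OF D(1) C] by blast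
      qed
      then have "card ?\<C> = card (\<C> - {C}) + card \<D>'"
        using finC \<open>finite \<D>'\<close> by (simp add: card_Un_disjoint)
      moreover have "Suc (card (\<C> - {C})) = card \<C>"
        using C finC by (metis card_Suc_Diff1)
      moreover have "finite T" using G(1) finCC finite_subset by blast
      moreover have "card ?S = Suc (card S + card T)"
      proof -
        have "S \<inter> T = {}" "v \<notin> S \<union> T" using G(1) CW v by auto
        then show ?thesis using finS \<open>finite T\<close> by (simp add: card_Un_disjoint)
      qed
      ultimately have "card ?S \<le> card ?\<C>" and big: "card S < card ?S"
        using card eq by linarith+
      then have "P ?S" using fam' cond[OF fam'] unfolding P_def by (metis le_antisym)
      then show False using max big by (metis not_le)
    qed
  qed
  \<comment> \<open>Hall's condition holds because every subfamily is an odd family with respect to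
    its own neighbours in \<open>S\<close>.\<close>
  have "\<exists>f. inj_on f \<C> \<and> (\<forall>C\<in>\<C>. f C \<in> {s \<in> S. \<exists>x\<in>C. {x, s} \<in> E})"
  proof (rule hall)
    fix \<J> assume J: "\<J> \<subseteq> \<C>"
    let ?N = "\<Union>C\<in>\<J>. {s \<in> S. \<exists>x\<in>C. {x, s} \<in> E}"
    have "pairwise disjnt \<J>" using F(2) J pairwise_subset by blast
    moreover have "C \<subseteq> W - ?N" "odd (card C)" if "C \<in> \<J>" for C
      using that J F(3)[of C] F(4)[of C] by auto
    moreover have "y \<in> C \<union> ?N" if "C \<in> \<J>" "x \<in> C" "y \<in> W" "{x, y} \<in> E" for C x y
      using that J F(6)[of C x y] by blast
    moreover have "?N \<subseteq> W" using F(1) by auto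
    ultimately have "odd_family E W ?N \<J>"
      unfolding odd_family_def by simp
    then show "card \<J> \<le> card ?N" using cond by blast
  qed (use finC finS in auto)
  then obtain f where f: "inj_on f \<C>" "\<And>C. C \<in> \<C> \<Longrightarrow> f C \<in> S \<and> (\<exists>x\<in>C. {x, f C} \<in> E)"
    by auto
  have fS: "f ` \<C> = S"
    using f eq finS by (metis card_image card_subset_eq image_subsetI)
  obtain g where g: "\<And>C. C \<in> \<C> \<Longrightarrow> g C \<in> C \<and> {g C, f C} \<in> E"
    using f(2) by metis
  have "\<forall>C\<in>\<C>. \<exists>M. perfect_matching (C - {g C}) (induced_edges E (C - {g C})) M"
    using pmC g by blast
  then obtain M where M: "\<And>C. C \<in> \<C> \<Longrightarrow>
      perfect_matching (C - {g C}) (induced_edges E (C - {g C})) (M C)"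
    using bchoice[of \<C> "\<lambda>C. perfect_matching (C - {g C}) (induced_edges E (C - {g C}))"] by blast
  \<comment> \<open>The edge from \<open>g C\<close> covers the partner \<open>f C\<close>, and the
    matching of \<open>C - {g C}\<close> covers the rest of the odd set.\<close>
  have pm: "perfect_matching (insert (f C) C) (induced_edges E (insert (f C) C))
      (insert {g C, f C} (M C))" if C: "C \<in> \<C>" for C
  proof -
    have "M C \<subseteq> E" "\<And>e. e \<in> M C \<Longrightarrow> e \<subseteq> C - {g C}" "pairwise disjnt (M C)" "\<Union>(M C) = C - {g C}"
      using M[OF C] unfolding perfect_matching_def matching_def induced_edges_def by blast+
    moreover have "f C \<notin> C" using f(2) F(3) C by blast
    ultimately show ?thesis
      using g[OF C] unfolding perfect_matching_def matching_def induced_edges_def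
      by (auto simp: pairwise_insert disjnt_def)
  qed
  have disj: "insert (f C) C \<inter> insert (f D) D = {}" if "C \<in> \<C>" "D \<in> \<C>" "C \<noteq> D" for C D
  proof -
    have "f C \<noteq> f D" using f(1) that unfolding inj_on_def by blast
    moreover have "f C \<notin> C \<union> D" "f D \<notin> C \<union> D" using f(2) F(3) that by blast+
    ultimately show ?thesis using F(7) that by blast
  qed
  have "(\<Union>C\<in>\<C>. insert (f C) C) = S \<union> \<Union>\<C>" using fS by auto
  also have "\<dots> = W" using R F(1,3) by blast
  finally show ?case
    using perfect_matching_Union[of \<C> "\<lambda>C. insert (f C) C" E "\<lambda>C. insert {g C, f C} (M C)",
        OF finC pm disj] by auto
qed

section \<open>Neighbourhoods, claws and separators\<close>

definition nbrs :: "'a set set \<Rightarrow> 'a \<Rightarrow> 'a set" where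
  "nbrs E v = {w. {v, w} \<in> E}"

lemma nbrs_sym: "w \<in> nbrs E v \<longleftrightarrow> v \<in> nbrs E w"
  by (simp add: nbrs_def insert_commute)

lemma nbrs_simple_graph:
  assumes "simple_graph V E" "w \<in> nbrs E v"
  shows "v \<in> V" "w \<in> V" "v \<noteq> w"
proof -
  have "{v, w} \<subseteq> V" and card: "card {v, w} = 2"
    using assms unfolding simple_graph_def nbrs_def by auto
  then show "v \<in> V" "w \<in> V" by auto
  show "v \<noteq> w" using card by auto
qed

lemma finite_nbrs: "simple_graph V E \<Longrightarrow> finite (nbrs E v)"
  by (meson finite_subset nbrs_simple_graph(2) simple_graph_def subsetI)

lemma degree_eq_card_nbrs:
  assumes "simple_graph V E"
  shows "degree E v = card (nbrs E v)"
proof -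
  have "e \<in> (\<lambda>w. {v, w}) ` nbrs E v" if "e \<in> E" "v \<in> e" for e
  proof -
    have "card e = 2" using assms that unfolding simple_graph_def by blast
    then obtain w where "e = {v, w}"
      using \<open>v \<in> e\<close> by (metis card_2_iff insert_iff insert_commute singletonD)
    then show ?thesis using that unfolding nbrs_def by blast
  qed
  then have "{e \<in> E. v \<in> e} = (\<lambda>w. {v, w}) ` nbrs E v"
    unfolding nbrs_def by auto
  moreover have "inj_on (\<lambda>w. {v, w}) (nbrs E v)"
    by (auto simp: inj_on_def doubleton_eq_iff)
  ultimately show ?thesis unfolding degree_def by (simp add: card_image)
qed

lemma claw_freeD:
  assumes G: "simple_graph V E" and cf: "claw_free V E"
    and nb: "a \<in> nbrs E x" "b \<in> nbrs E x" "c \<in> nbrs E x"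
    and dist: "a \<noteq> b" "a \<noteq> c" "b \<noteq> c"
  shows "b \<in> nbrs E a \<or> c \<in> nbrs E a \<or> c \<in> nbrs E b"
proof (rule ccontr)
  assume no: "\<not> ?thesis"
  let ?W = "{x, a, b, c}"
  define f :: "'a \<Rightarrow> nat" where
    "f = (\<lambda>y. if y = x then 0 else if y = a then 1 else if y = b then 2 else 3)"
  have neq: "x \<noteq> a" "x \<noteq> b" "x \<noteq> c"
    using nbrs_simple_graph(3)[OF G] nb by blast+
  have f: "f x = 0" "f a = 1" "f b = 2" "f c = 3"
    using neq dist unfolding f_def by auto
  have loop: "{y, y} \<notin> E" for y
    using G unfolding simple_graph_def by force
  have E: "{x, a} \<in> E" "{x, b} \<in> E" "{x, c} \<in> E" "{a, b} \<notin> E" "{a, c} \<notin> E" "{b, c} \<notin> E"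
    "{a, x} \<in> E" "{b, x} \<in> E" "{c, x} \<in> E" "{b, a} \<notin> E" "{c, a} \<notin> E" "{c, b} \<notin> E"
    using nb no by (auto simp: nbrs_def insert_commute)
  have "bij_betw f ?W claw_verts"
    unfolding bij_betw_def inj_on_def claw_verts_def using neq dist f by auto
  moreover have "\<forall>u\<in>?W. \<forall>v\<in>?W. {u, v} \<in> induced_edges E ?W \<longleftrightarrow> {f u, f v} \<in> claw_edges"
    using f E loop by (simp add: induced_edges_def claw_edges_def doubleton_eq_iff)
  ultimately have "graph_isomorphic ?W (induced_edges E ?W) claw_verts claw_edges"
    unfolding graph_isomorphic_def by blast
  moreover have "?W \<subseteq> V" using nbrs_simple_graph[OF G] nb by blast
  ultimately show False using cf unfolding claw_free_def by blast
qed

text \<open>A path from \<open>y\<close> that avoids \<open>Z\<close> never leaves \<open>Y\<close>,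
  so \<open>Z\<close> separates \<open>y\<close> from \<open>v\<close>. The later separator
  arguments are all choices of \<open>Y\<close>, \<open>Z\<close> and the outer vertex
  \<open>v\<close>.\<close>

lemma k_connected_card_boundary:
  assumes G: "simple_graph V E" and conn: "k_connected m V E"
    and Y: "y \<in> Y" "Y \<subseteq> V" and Z: "Z \<subseteq> V" "Y \<inter> Z = {}"
    and closed: "\<And>x w. x \<in> Y \<Longrightarrow> w \<in> nbrs E x \<Longrightarrow> w \<in> Y \<union> Z"
    and v: "v \<in> V" "v \<notin> Y" "v \<notin> Z"
  shows "m \<le> card Z"
proof (rule ccontr)
  assume "\<not> ?thesis"
  then have "graph_connected (V - Z) (induced_edges E (V - Z))"
    using conn Z unfolding k_connected_def by auto
  then have "(y, v) \<in> {(x, y). {x, y} \<in> induced_edges E (V - Z)}\<^sup>*"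
    using Y Z v unfolding graph_connected_def by blast
  then have "v \<in> Y"
  proof induction
    case base
    then show ?case using Y by simp
  next
    case (step x w)
    then have "w \<in> nbrs E x" "w \<notin> Z" unfolding induced_edges_def nbrs_def by auto
    then show ?case using closed step by blast
  qed
  then show False using v by simp
qed

lemma k_connected_card_nbrs:
  assumes G: "simple_graph V E" and conn: "k_connected m V E" and v: "v \<in> V"
  shows "m \<le> card (nbrs E v)"
proof (cases "V \<subseteq> insert v (nbrs E v)")
  \<comment> \<open>If \<open>v\<close> is adjacent to all other vertices, its neighbourhood
    separates nothing, and the bound comes from \<open>m < card V\<close>.\<close>
  case True
  then have "card V \<le> Suc (card (nbrs E v))"
    using finite_nbrs[OF G] card_mono[OF _ True]
    by (simp add: card_insert_if split: if_splits)
  then show ?thesis using conn unfolding k_connected_def by simp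
next
  case False
  then obtain w where "w \<in> V" "w \<noteq> v" "w \<notin> nbrs E v" by blast
  then show ?thesis
    using nbrs_simple_graph[OF G, of _ v] v
    by (intro k_connected_card_boundary[OF G conn, of v "{v}" _ w]) blast+
qed

text \<open>
  If \<open>c\<close> is the only vertex of \<open>C\<close> with a neighbour outside \<open>C \<union> S\<close>, then \<open>c\<close> together with the
  neighbours of \<open>C - {c}\<close> in \<open>S\<close> separates \<open>C - {c}\<close> from that outer neighbour.
\<close>

lemma card_boundary_minus_vertex:
  assumes G: "simple_graph V E" and conn: "k_connected (k + 1) V E"
    and C: "C \<subseteq> V" "c \<in> C" "C \<noteq> {c}" and S: "S \<subseteq> V" "C \<inter> S = {}"
    and closed: "\<And>x y. x \<in> C \<Longrightarrow> y \<in> nbrs E x \<Longrightarrow> y \<in> C \<union> S \<or> x = c"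
    and v: "v \<in> V" "v \<notin> C" "v \<notin> S"
  shows "k \<le> card {s \<in> S. \<exists>x\<in>C - {c}. s \<in> nbrs E x}"
proof -
  let ?N = "{s \<in> S. \<exists>x\<in>C - {c}. s \<in> nbrs E x}"
  obtain y where "y \<in> C - {c}" using C by blast
  then have "k + 1 \<le> card (insert c ?N)"
  proof (rule k_connected_card_boundary[OF G conn, where v = v])
    fix x w assume "x \<in> C - {c}" "w \<in> nbrs E x"
    then show "w \<in> (C - {c}) \<union> insert c ?N" using closed[of x w] by auto
  qed (use C S v in auto)
  moreover have "finite ?N"
    using S G unfolding simple_graph_def by (auto intro: finite_subset)
  moreover have "c \<notin> ?N" using C S by auto
  ultimately show ?thesis by simp
qed

text \<open>If \<open>C = {c}\<close>, all neighbours of \<open>c\<close> except possibly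
  \<open>v\<close> lie in \<open>S\<close>, so the degree gives the bound. Otherwise
  \<open>C - {c}\<close> alone already sees \<open>k\<close> vertices of \<open>S\<close>.\<close>

lemma card_boundary_with_vertex:
  assumes G: "simple_graph V E" and conn: "k_connected (k + 1) V E"
    and C: "C \<subseteq> V" "c \<in> C" and S: "S \<subseteq> V" "C \<inter> S = {}"
    and closed: "\<And>x y. x \<in> C \<Longrightarrow> y \<in> nbrs E x \<Longrightarrow> y \<in> C \<union> S \<or> x = c \<and> y = v"
    and v: "v \<in> V" "v \<notin> C" "v \<notin> S" and deg: "k + 1 \<le> card (nbrs E c)"
  shows "k \<le> card {s \<in> S. \<exists>x\<in>C. s \<in> nbrs E x}"
proof -
  let ?N = "{s \<in> S. \<exists>x\<in>C. s \<in> nbrs E x}"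
  have fin: "finite ?N" using S G unfolding simple_graph_def by (auto intro: finite_subset)
  show ?thesis
  proof (cases "C = {c}")
    case True
    have "nbrs E c \<subseteq> insert v ?N"
      using closed[of c] True nbrs_simple_graph(3)[OF G, of c c] C by auto
    then have "card (nbrs E c) \<le> card (insert v ?N)"
      using fin by (intro card_mono) auto
    then show ?thesis using deg card_insert_le_m1 fin v by simp
  next
    case False
    have "k \<le> card {s \<in> S. \<exists>x\<in>C - {c}. s \<in> nbrs E x}"
      using closed by (intro card_boundary_minus_vertex[OF G conn C False S _ v]) auto
    also have "\<dots> \<le> card ?N" using fin by (intro card_mono) auto
    finally show ?thesis .
  qed
qed

section \<open>Edges that become bridges\<close>

text \<open>For adjacent \<open>u\<close> and \<open>v\<close> this says that \<open>uv\<close> is a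
  bridge of \<open>G - S\<close>. The partition into two sides avoids any mention of components and
  makes the sides available for uncrossing.\<close>

definition bridge_separation ::
    "'a set \<Rightarrow> 'a set set \<Rightarrow> nat \<Rightarrow> 'a \<Rightarrow> 'a \<Rightarrow> 'a set \<Rightarrow> 'a set \<Rightarrow> 'a set \<Rightarrow> bool" where
  "bridge_separation V E k u v A S B \<longleftrightarrow>
     V = A \<union> S \<union> B \<and> A \<inter> S = {} \<and> A \<inter> B = {} \<and> S \<inter> B = {} \<and> card S = k \<and> u \<in> A \<and> v \<in> B \<and>
     (\<forall>x\<in>A. \<forall>y\<in>B. y \<in> nbrs E x \<longrightarrow> x = u \<and> y = v)"

lemma bridge_separation_sym:
  "bridge_separation V E k u v A S B \<Longrightarrow> bridge_separation V E k v u B S A"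
  unfolding bridge_separation_def using nbrs_sym[of _ E] by blast

text \<open>A common neighbour in \<open>A\<close> or in \<open>B\<close> would give a second edge
  between the two sides.\<close>

lemma bridge_separation_common_nbr:
  assumes "simple_graph V E" "bridge_separation V E k u v A S B" "w \<in> nbrs E u" "w \<in> nbrs E v"
  shows "w \<in> S"
  using assms nbrs_simple_graph[OF assms(1) assms(3)] nbrs_simple_graph[OF assms(1) assms(4)]
    nbrs_sym[of w E]
  unfolding bridge_separation_def by blast

lemma card_inter3:
  assumes "finite T" "T \<subseteq> A \<union> S \<union> B" "A \<inter> S = {}" "A \<inter> B = {}" "S \<inter> B = {}"
  shows "card T = card (T \<inter> A) + card (T \<inter> S) + card (T \<inter> B)"
proof -
  have "T = (T \<inter> A) \<union> (T \<inter> S) \<union> (T \<inter> B)" using assms(2) by blast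
  then have "card T = card ((T \<inter> A) \<union> (T \<inter> S)) + card (T \<inter> B)"
    using assms by (metis card_Un_disjoint finite_Int finite_Un inf_assoc inf_bot_right inf_left_commute
        inf_sup_distrib2 sup_bot_right)
  then show ?thesis
    using assms by (subst (asm) card_Un_disjoint) auto
qed

lemma card_2_le: "card {x, y} \<le> 2"
  by (simp add: card_insert_if)

lemma card_Un3_le: "card (A \<union> B \<union> C) \<le> card A + card B + card C"
  by (meson add_le_mono1 card_Un_le le_trans)

text \<open>
  Uncrossing two separations that share the vertex \<open>v\<close>. Opposite corners of the resulting grid have
  boundaries of total size \<open>2k\<close>, whereas a nonempty corner avoiding both bridges needs a boundary of
  size \<open>k + 1\<close>.
\<close>

lemma bridge_separation_uncross:
  assumes G: "simple_graph V E" and conn: "k_connected (k + 1) V E"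
    and uv: "bridge_separation V E k u v A S B" and vw: "bridge_separation V E k v w A' S' B'"
    and adj: "v \<in> nbrs E u" "w \<in> nbrs E v" "w \<in> nbrs E u"
    and deg: "k + 2 \<le> card (nbrs E v)"
    and le: "card B \<le> card A'" "card B \<le> card B'"
  shows False
proof -
  have finV: "finite V" using G unfolding simple_graph_def by blast
  have P: "V = A \<union> S \<union> B" "A \<inter> S = {}" "A \<inter> B = {}" "S \<inter> B = {}" "card S = k" "u \<in> A" "v \<in> B"
    and X: "\<And>x y. x \<in> A \<Longrightarrow> y \<in> B \<Longrightarrow> y \<in> nbrs E x \<Longrightarrow> x = u \<and> y = v"
    using uv unfolding bridge_separation_def by blast+
  have P': "V = A' \<union> S' \<union> B'" "A' \<inter> S' = {}" "A' \<inter> B' = {}" "S' \<inter> B' = {}" "card S' = k"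
      "v \<in> A'" "w \<in> B'"
    and X': "\<And>x y. x \<in> A' \<Longrightarrow> y \<in> B' \<Longrightarrow> y \<in> nbrs E x \<Longrightarrow> x = v \<and> y = w"
    using vw unfolding bridge_separation_def by blast+
  have wS: "w \<in> S" using bridge_separation_common_nbr[OF G uv] adj by blast
  have uS': "u \<in> S'" using bridge_separation_common_nbr[OF G vw] adj nbrs_sym[of _ E] by blast
  have fins: "finite A" "finite B" "finite S" "finite A'" "finite B'" "finite S'"
    using finV unfolding P(1) by simp_all (use finV P'(1) in auto)
  \<comment> \<open>The two separations cut \<open>V\<close> into a grid with \<open>v\<close> in
    the corner \<open>B \<inter> A'\<close>, \<open>u\<close> in \<open>A \<inter> S'\<close> and
    \<open>w\<close> in \<open>S \<inter> B'\<close>. The letters are the sizes of the centre and of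
    the four cells next to it.\<close>
  define a b s a' b' where "a = card (A \<inter> S')" and "b = card (B \<inter> S')" and "s = card (S \<inter> S')"
    and "a' = card (S \<inter> A')" and "b' = card (S \<inter> B')"
  have k: "k = a' + s + b'"
    using card_inter3[of S A' S' B'] P P' fins unfolding a'_def b'_def s_def by auto
  have k': "k = a + s + b"
    using card_inter3[of S' A S B] P P' fins unfolding a_def b_def s_def by (auto simp: Int_commute)
  have "card V = card A + k + card B"
    unfolding P(1) using fins P(2-5) by (simp add: card_Un_disjoint Int_Un_distrib2)
  moreover have "card V = card A' + k + card B'"
    unfolding P'(1) using fins P'(2-5) by (simp add: card_Un_disjoint Int_Un_distrib2)
  ultimately have AB: "card A + card B = card A' + card B'" by simp
  have notin: "u \<notin> A'" "u \<notin> B'" "u \<notin> B" "u \<notin> S" "w \<notin> A" "w \<notin> B" "w \<notin> A'" "w \<notin> S'"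
    "v \<notin> A" "v \<notin> S" "v \<notin> S'" "v \<notin> B'"
    using P(2-4,6,7) P'(2-4,6,7) wS uS' by blast+
  \<comment> \<open>Moving \<open>v\<close> from the corner to its boundary disposes of both bridges
    at once, since their other ends \<open>u\<close> and \<open>w\<close> lie in no corner.\<close>
  have corner: "k + 1 \<le> card ((P \<inter> S') \<union> (S \<inter> S') \<union> (S \<inter> Q) \<union> (P \<inter> Q \<inter> {v}))"
    if PQ: "P \<in> {A, B}" "Q \<in> {A', B'}" "y \<in> P \<inter> Q - {v}" for P Q y
  proof -
    obtain z where z: "z \<in> {u, v, w}" "z \<notin> (P \<union> S) \<inter> (Q \<union> S')"
    proof (cases "P = B")
      case True
      then show ?thesis using that[of u] notin by blast
    next
      case False
      then show ?thesis using that[of v] PQ(1) notin by blast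
    qed
    show ?thesis
    proof (rule k_connected_card_boundary[OF G conn PQ(3), where v = z])
      fix x t assume x: "x \<in> P \<inter> Q - {v}" and t: "t \<in> nbrs E x"
      have "x \<noteq> u" "x \<noteq> v" "x \<noteq> w" using x PQ(1,2) notin by auto
      have tV: "t \<in> A \<union> S \<union> B" "t \<in> A' \<union> S' \<union> B'"
        using nbrs_simple_graph(2)[OF G t] P(1) P'(1) by simp_all
      have xt: "x \<in> nbrs E t" using t nbrs_sym[of x E t] by simp
      have "t \<in> P \<union> S"
        using X[of x t] X[of t x] x t xt PQ(1) tV(1) \<open>x \<noteq> u\<close> \<open>x \<noteq> v\<close> by auto
      moreover have "t \<in> Q \<union> S'"
        using X'[of x t] X'[of t x] x t xt PQ(2) tV(2) \<open>x \<noteq> v\<close> \<open>x \<noteq> w\<close> by auto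
      ultimately show "t \<in> (P \<inter> Q - {v}) \<union> ((P \<inter> S') \<union> (S \<inter> S') \<union> (S \<inter> Q) \<union> (P \<inter> Q \<inter> {v}))"
        by blast
    next
      show "z \<in> V" using z(1) nbrs_simple_graph[OF G] adj by blast
      have "P \<subseteq> V" "S \<subseteq> V" using PQ(1) P(1) by auto
      then show "P \<inter> Q - {v} \<subseteq> V"
        "(P \<inter> S') \<union> (S \<inter> S') \<union> (S \<inter> Q) \<union> (P \<inter> Q \<inter> {v}) \<subseteq> V" by blast+
      have "P \<inter> S = {}" "Q \<inter> S' = {}" using PQ(1,2) P(2,4) P'(2,4) by auto
      then show "(P \<inter> Q - {v}) \<inter> ((P \<inter> S') \<union> (S \<inter> S') \<union> (S \<inter> Q) \<union> (P \<inter> Q \<inter> {v})) = {}"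
        by blast
    qed (use z(2) in blast)+
  qed
  \<comment> \<open>The corner holding \<open>v\<close> yields only \<open>k\<close>: if it is
    \<open>{v}\<close>, from the degree of \<open>v\<close> less \<open>u\<close> and
    \<open>w\<close>; otherwise from the boundary bound \<open>k + 1\<close> less
    \<open>v\<close>.\<close>
  have "k \<le> b + s + a'"
  proof (cases "B \<inter> A' - {v} = {}")
    case True
    have "nbrs E v \<subseteq> ((B \<inter> S') \<union> (S \<inter> S') \<union> (S \<inter> A')) \<union> {u, w}"
    proof
      fix t assume t: "t \<in> nbrs E v"
      note t' = nbrs_simple_graph[OF G t]
      have "t \<in> S \<union> B \<or> t = u" using X[of t v] t t'(2) P nbrs_sym[of v E t] by blast
      moreover have "t \<in> A' \<union> S' \<or> t = w" using X'[of v t] t t'(2) P' by blast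
      moreover have "t \<notin> B \<inter> A'" using True t'(3) by blast
      ultimately show "t \<in> ((B \<inter> S') \<union> (S \<inter> S') \<union> (S \<inter> A')) \<union> {u, w}" by blast
    qed
    then have "card (nbrs E v) \<le> card (((B \<inter> S') \<union> (S \<inter> S') \<union> (S \<inter> A')) \<union> {u, w})"
      using fins by (intro card_mono) auto
    also have "\<dots> \<le> card ((B \<inter> S') \<union> (S \<inter> S') \<union> (S \<inter> A')) + card {u, w}"
      by (rule card_Un_le)
    also have "\<dots> \<le> (b + s + a') + 2"
      unfolding a'_def b_def s_def by (intro add_mono card_Un3_le card_2_le)
    finally show ?thesis using deg by simp
  next
    case False
    then have "k + 1 \<le> card ((B \<inter> S') \<union> (S \<inter> S') \<union> (S \<inter> A') \<union> (B \<inter> A' \<inter> {v}))"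
      using corner[of B A'] by blast
    also have "\<dots> \<le> card ((B \<inter> S') \<union> (S \<inter> S') \<union> (S \<inter> A')) + card (B \<inter> A' \<inter> {v})"
      by (rule card_Un_le)
    also have "\<dots> \<le> (b + s + a') + card {v}"
      unfolding a'_def b_def s_def by (intro add_mono card_Un3_le card_mono) auto
    finally show ?thesis by simp
  qed
  have corner_le: "k + 1 \<le> card (P \<inter> S') + s + card (S \<inter> Q)"
    if PQ: "P \<in> {A, B}" "Q \<in> {A', B'}" "P \<inter> Q \<noteq> {}" "v \<notin> P \<inter> Q" for P Q
  proof -
    obtain y where "y \<in> P \<inter> Q - {v}" using PQ by blast
    from corner[OF PQ(1,2) this]
    have "k + 1 \<le> card ((P \<inter> S') \<union> (S \<inter> S') \<union> (S \<inter> Q))" using PQ(4) by simp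
    also have "\<dots> \<le> card (P \<inter> S') + s + card (S \<inter> Q)"
      unfolding s_def by (rule card_Un3_le)
    finally show ?thesis .
  qed
  \<comment> \<open>The boundary of this corner has size
    \<open>a + s + b' = 2 * k - (b + s + a')\<close>, which is at most \<open>k\<close> and so too
    small.\<close>
  have AB': "A \<inter> B' = {}"
    using corner_le[of A B'] notin k k' \<open>k \<le> b + s + a'\<close> unfolding a_def b'_def by fastforce
  \<comment> \<open>If \<open>B \<inter> B'\<close> were nonempty, the opposite corner would be
    empty and all of \<open>A\<close> would lie in \<open>S'\<close>. Counting then gives
    \<open>card A < card B'\<close>, that is, \<open>card A' < card B\<close>.\<close>
  have BB': "B \<inter> B' = {}"
  proof (rule ccontr)
    assume "B \<inter> B' \<noteq> {}"
    then have "k + 1 \<le> b + s + b'" using corner_le[of B B'] notin unfolding b_def b'_def by blast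
    moreover from this have "A \<inter> A' = {}"
      using corner_le[of A A'] notin k k' unfolding a_def a'_def by fastforce
    then have "A \<subseteq> S'" using AB' P(1) P'(1) by blast
    then have "a = card A" unfolding a_def by (simp add: Int_absorb2)
    moreover have "b' \<le> card B'" unfolding b'_def using fins by (intro card_mono) auto
    ultimately show False using k' AB le by linarith
  qed
  \<comment> \<open>Now \<open>card B' = b' \<le> b < card B\<close>, against the minimality of
    \<open>card B\<close>.\<close>
  then have "B' \<subseteq> S" using AB' P(1) P'(1) by blast
  then have "b' = card B'" unfolding b'_def by (simp add: Int_absorb1)
  moreover have "b < card B"
    unfolding b_def using P(7) notin fins by (intro psubset_card_mono) auto
  ultimately show False using k \<open>k \<le> b + s + a'\<close> le by linarith
qed

text \<open>The smallest of the six sides of the three separations violates the uncrossing lemma.\<close>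

lemma bridge_separation_no_triangle:
  assumes G: "simple_graph V E" and conn: "k_connected (k + 1) V E"
    and adj: "v \<in> nbrs E u" "w \<in> nbrs E v" "w \<in> nbrs E u"
    and deg: "k + 2 \<le> card (nbrs E u)" "k + 2 \<le> card (nbrs E v)" "k + 2 \<le> card (nbrs E w)"
    and sep: "bridge_separation V E k u v A S B" "bridge_separation V E k v w A' S' B'"
      "bridge_separation V E k w u A'' S'' B''"
  shows False
proof -
  note unc = bridge_separation_uncross[OF G conn]
  note sep' = sep[THEN bridge_separation_sym]
  note adj' = adj adj[THEN nbrs_sym[THEN iffD1]]
  have "\<not> (card B \<le> card A' \<and> card B \<le> card B')" using unc[OF sep(1,2)] adj' deg by blast
  moreover have "\<not> (card A' \<le> card B \<and> card A' \<le> card A)"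
    using unc[OF sep'(2,1)] adj' deg by blast
  moreover have "\<not> (card B' \<le> card A'' \<and> card B' \<le> card B'')"
    using unc[OF sep(2,3)] adj' deg by blast
  moreover have "\<not> (card A'' \<le> card B' \<and> card A'' \<le> card A')"
    using unc[OF sep'(3,2)] adj' deg by blast
  moreover have "\<not> (card B'' \<le> card A \<and> card B'' \<le> card B)"
    using unc[OF sep(3,1)] adj' deg by blast
  moreover have "\<not> (card A \<le> card B'' \<and> card A \<le> card A'')"
    using unc[OF sep'(1,3)] adj' deg by blast
  ultimately show False by linarith
qed

section \<open>Edges between vertices of large degree\<close>

text \<open>For adjacent \<open>u\<close> and \<open>v\<close> the first conjunct says that their
  closed neighbourhoods agree. The second gives every common neighbour a neighbour outside this set,
  so that no edge from \<open>u\<close> to a common neighbour is again a twin edge.\<close>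

definition twin_edge :: "'a set set \<Rightarrow> 'a \<Rightarrow> 'a \<Rightarrow> bool" where
  "twin_edge E u v \<longleftrightarrow> nbrs E u - {v} = nbrs E v - {u} \<and>
     (\<forall>s\<in>nbrs E u - {v}. \<exists>z\<in>nbrs E s. z \<noteq> u \<and> z \<notin> nbrs E u)"

text \<open>If \<open>uw\<close> is a bridge of \<open>G - S\<close>, the common neighbour
  \<open>v\<close> lies in \<open>S\<close>. Being a twin of \<open>u\<close>, it has no neighbour
  in \<open>B - {w}\<close>, so \<open>w\<close> and \<open>S - {v}\<close>, only \<open>k\<close>
  vertices, separate \<open>B - {w}\<close> from \<open>u\<close>. The degree of \<open>w\<close>
  makes \<open>B - {w}\<close> nonempty.\<close>

lemma twin_edge_no_triangle:
  assumes G: "simple_graph V E" and conn: "k_connected (k + 1) V E"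
    and uv: "twin_edge E u v" "v \<in> nbrs E u" and w: "w \<in> nbrs E u" "w \<noteq> v"
    and deg: "k + 2 \<le> card (nbrs E w)"
    and uw: "(\<exists>A S B. bridge_separation V E k u w A S B) \<or> twin_edge E u w"
  shows False
  using uw
proof
  assume "twin_edge E u w"
  moreover obtain z where "z \<in> nbrs E w" "z \<noteq> u" "z \<notin> nbrs E u"
    using uv w unfolding twin_edge_def by blast
  ultimately show False unfolding twin_edge_def by blast
next
  assume "\<exists>A S B. bridge_separation V E k u w A S B"
  then obtain A S B where sep: "bridge_separation V E k u w A S B" by blast
  then have P: "V = A \<union> S \<union> B" "A \<inter> S = {}" "A \<inter> B = {}" "S \<inter> B = {}" "card S = k" "u \<in> A" "w \<in> B"
    and X: "\<And>x y. x \<in> A \<Longrightarrow> y \<in> B \<Longrightarrow> y \<in> nbrs E x \<Longrightarrow> x = u \<and> y = w"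
    unfolding bridge_separation_def by blast+
  have "finite V" using G unfolding simple_graph_def by blast
  then have finS: "finite S" using P(1) by simp
  have twin: "nbrs E u - {v} = nbrs E v - {u}" using uv unfolding twin_edge_def by blast
  have "w \<in> nbrs E v" using twin w by blast
  then have vS: "v \<in> S"
    using bridge_separation_common_nbr[OF G sep uv(2)] nbrs_sym[of v E w] by blast
  have "B \<noteq> {w}"
  proof
    assume B: "B = {w}"
    have "nbrs E w \<subseteq> insert u S"
    proof
      fix t assume t: "t \<in> nbrs E w"
      then show "t \<in> insert u S"
        using X[of t w] nbrs_simple_graph[OF G t] B P nbrs_sym[of t E w] by blast
    qed
    then have "card (nbrs E w) \<le> card (insert u S)" using finS by (intro card_mono) auto
    also have "\<dots> \<le> Suc k" using finS P(5) by (simp add: card_insert_if)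
    finally show False using deg by simp
  qed
  then obtain y where y: "y \<in> B - {w}" using P by blast
  have "k + 1 \<le> card (insert w (S - {v}))"
  proof (rule k_connected_card_boundary[OF G conn y, where v = u])
    fix x t assume x: "x \<in> B - {w}" and t: "t \<in> nbrs E x"
    have "t \<notin> A" using X[of t x] x t nbrs_sym[of t E x] by blast
    moreover have "t \<noteq> v"
    proof
      assume "t = v"
      then have "x \<in> nbrs E u" using t x twin P nbrs_sym[of x E v] by blast
      then show False using X[of u x] x P by blast
    qed
    ultimately show "t \<in> (B - {w}) \<union> insert w (S - {v})"
      using nbrs_simple_graph(2)[OF G t] P(1) by blast
  qed (use P in blast)+
  also have "\<dots> = Suc (card (S - {v}))"
    using P(4,7) finS by (intro card_insert_disjoint) auto
  also have "\<dots> = k" using card_Suc_Diff1[OF finS vS] P(5) by simp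
  finally show False by simp
qed

text \<open>
  Each member of \<open>\<P>\<close> has at least \<open>k + 1\<close> neighbours in \<open>S\<close>, while in a claw-free graph a vertex of
  \<open>S\<close> is adjacent to at most two of them.
\<close>

lemma claw_free_incidence_bound:
  assumes G: "simple_graph V E" and cf: "claw_free V E" and conn: "k_connected m V E"
    and S: "S \<subseteq> V" and P: "finite \<P>" "card \<P> \<ge> 2" "pairwise disjnt \<P>"
    and sub: "\<And>P. P \<in> \<P> \<Longrightarrow> P \<noteq> {} \<and> P \<subseteq> V - S"
    and closed: "\<And>P x y. P \<in> \<P> \<Longrightarrow> x \<in> P \<Longrightarrow> y \<in> nbrs E x \<Longrightarrow> y \<in> P \<union> S"
  shows "\<And>P. P \<in> \<P> \<Longrightarrow> m \<le> card {s \<in> S. \<exists>x\<in>P. s \<in> nbrs E x}"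
    and "m * card \<P> \<le> 2 * card S"
proof -
  have finS: "finite S" using G S finite_subset unfolding simple_graph_def by blast
  have disj: "P = Q" if "P \<in> \<P>" "Q \<in> \<P>" "x \<in> P" "x \<in> Q" for P Q x
    using P(3) that unfolding pairwise_def disjnt_def by blast
  show lower: "m \<le> card {s \<in> S. \<exists>x\<in>P. s \<in> nbrs E x}" if PP: "P \<in> \<P>" for P
  proof -
    have "\<not> \<P> \<subseteq> {P}" using P(1,2) card_mono[of "{P}" \<P>] by auto
    then obtain Q where Q: "Q \<in> \<P>" "Q \<noteq> P" by blast
    obtain y where y: "y \<in> P" using sub[OF PP] by blast
    obtain z where z: "z \<in> Q" using sub[OF Q(1)] by blast
    have "z \<notin> P" using disj Q z PP by blast
    show ?thesis
    proof (rule k_connected_card_boundary[OF G conn y, where v = z])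
      fix x w assume "x \<in> P" "w \<in> nbrs E x"
      then show "w \<in> P \<union> {s \<in> S. \<exists>x\<in>P. s \<in> nbrs E x}" using closed[OF PP] by blast
    qed (use sub[OF PP] sub[OF Q(1)] S z \<open>z \<notin> P\<close> in blast)+
  qed
  have upper: "card {P \<in> \<P>. \<exists>x\<in>P. s \<in> nbrs E x} \<le> 2" for s
  proof (rule ccontr)
    assume "\<not> ?thesis"
    then have "3 \<le> card {P \<in> \<P>. \<exists>x\<in>P. s \<in> nbrs E x}" by simp
    then obtain T where T: "T \<subseteq> {P \<in> \<P>. \<exists>x\<in>P. s \<in> nbrs E x}" "card T = 3"
      by (meson obtain_subset_with_card_n)
    then obtain P Q R where PQR: "T = {P, Q, R}" "P \<noteq> Q" "P \<noteq> R" "Q \<noteq> R"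
      by (metis card_3_iff)
    then have mem: "P \<in> \<P>" "Q \<in> \<P>" "R \<in> \<P>" using T by auto
    obtain x y z where xyz: "x \<in> P" "y \<in> Q" "z \<in> R" "s \<in> nbrs E x" "s \<in> nbrs E y" "s \<in> nbrs E z"
      using T PQR by auto
    have "x \<noteq> y" "x \<noteq> z" "y \<noteq> z" using disj mem xyz PQR by blast+
    then have "y \<in> nbrs E x \<or> z \<in> nbrs E x \<or> z \<in> nbrs E y"
      using claw_freeD[OF G cf, of x s y z] xyz nbrs_sym[of _ E] by blast
    then have "y \<in> P \<union> S \<or> z \<in> P \<union> S \<or> z \<in> Q \<union> S"
      using closed mem xyz by blast
    then show False using sub mem xyz disj PQR by blast
  qed
  have "m * card \<P> = (\<Sum>P\<in>\<P>. m)" by simp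
  also have "\<dots> \<le> (\<Sum>P\<in>\<P>. card {s \<in> S. \<exists>x\<in>P. s \<in> nbrs E x})"
    using lower by (rule sum_mono)
  also have "\<dots> = (\<Sum>s\<in>S. card {P \<in> \<P>. \<exists>x\<in>P. s \<in> nbrs E x})"
    by (rule sum_multicount_gen[OF P(1) finS]) simp
  also have "\<dots> \<le> (\<Sum>s\<in>S. 2)" using upper by (rule sum_mono)
  finally show "m * card \<P> \<le> 2 * card S" by simp
qed

text \<open>Some \<open>X\<close> of size \<open>k\<close> leaves \<open>G - uv - X\<close> without
  a perfect matching, so Tutte's theorem gives \<open>S0\<close> with at least
  \<open>card S0 + 2\<close> odd sets. Those containing neither \<open>u\<close> nor
  \<open>v\<close> remain odd sets in \<open>G - X\<close>, which has a perfect matching, so there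
  are at most \<open>card S0\<close> of them. Hence exactly two contain an end of \<open>uv\<close>,
  one end each, and \<open>S\<close> is \<open>S0 \<union> X\<close>.\<close>

lemma minimal_factor_critical_edge_family:
  assumes G: "simple_graph V E" and mfc: "minimal_factor_critical k V E"
    and uv: "v \<in> nbrs E u"
  obtains S \<D> Cu Cv where "S \<subseteq> V" "card S = card \<D> + k" "finite \<D>"
    "Cu \<subseteq> V - S" "u \<in> Cu" "Cu \<notin> \<D>" "Cv \<subseteq> V - S" "v \<in> Cv" "Cv \<notin> \<D>"
    "Cu \<noteq> Cv" "pairwise disjnt (insert Cu (insert Cv \<D>))"
    "\<And>C. C \<in> \<D> \<Longrightarrow> C \<noteq> {} \<and> C \<subseteq> V - S"
    "\<And>C x y. C \<in> insert Cu (insert Cv \<D>) \<Longrightarrow> x \<in> C \<Longrightarrow> y \<in> nbrs E x \<Longrightarrow>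
      {x, y} = {u, v} \<or> y \<in> C \<union> S"
proof -
  have finV: "finite V" and E2: "\<And>f. f \<in> E \<Longrightarrow> card f = 2"
    using G unfolding simple_graph_def by auto
  have e: "{u, v} \<in> E" using uv unfolding nbrs_def by simp
  let ?E = "E - {{u, v}}"
  have fc: "factor_critical k V E" "\<not> factor_critical k V ?E"
    using mfc e unfolding minimal_factor_critical_def by auto
  then obtain X where X: "X \<subseteq> V" "card X = k"
    and no: "\<nexists>M. perfect_matching (V - X) (induced_edges ?E (V - X)) M"
    unfolding factor_critical_def by blast
  define W where "W = V - X"
  obtain M where M: "perfect_matching W (induced_edges E W) M"
    using fc(1) X unfolding factor_critical_def W_def by blast
  have finW: "finite W" using finV unfolding W_def by simp
  have tut: "card \<C> \<le> card S" if "odd_family E W S \<C>" for S \<C>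
    using perfect_matching_odd_family[OF M that finW E2] .
  have even: "even (card W)"
  proof (rule ccontr)
    assume "odd (card W)"
    then have "odd_family E W {} {W}" unfolding odd_family_def by simp
    then show False using tut[of "{}" "{W}"] by simp
  qed
  have "\<not> (\<forall>S \<C>. odd_family ?E W S \<C> \<longrightarrow> card \<C> \<le> card S)"
    using tutte[OF finW even] no unfolding W_def by blast
  then obtain S0 \<C>0 where "odd_family ?E W S0 \<C>0" "card S0 < card \<C>0"
    by (meson not_le)
  then obtain S0 \<C> where fam: "odd_family ?E W S0 \<C>" and big: "card S0 + 2 \<le> card \<C>"
    using odd_family_excess_2 finW even by metis
  note F = odd_familyD[OF fam]
  have finC: "finite \<C>" using odd_family_finite[OF fam finW] .
  define \<D> where "\<D> = {C \<in> \<C>. u \<notin> C \<and> v \<notin> C}"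
  have finD: "finite \<D>" unfolding \<D>_def using finC by simp
  have "odd_family E W S0 \<D>"
  proof -
    have "y \<in> C \<union> S0" if "C \<in> \<D>" "x \<in> C" "y \<in> W" "{x, y} \<in> E" for C x y
      using F(6)[of C x y] that unfolding \<D>_def by (auto simp: doubleton_eq_iff)
    moreover have "pairwise disjnt \<D>"
      by (rule pairwise_subset[OF F(2)]) (auto simp: \<D>_def)
    ultimately show ?thesis using F(1,3,4) unfolding odd_family_def \<D>_def by simp
  qed
  then have D: "card \<D> \<le> card S0" by (rule tut)
  have cD: "card (\<C> - \<D>) + card \<D> = card \<C>"
    using finC card_Diff_subset[of \<D> \<C>] card_mono[of \<C> \<D>] finD unfolding \<D>_def by auto
  then have two: "2 \<le> card (\<C> - \<D>)" using D big by linarith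
  obtain Cu Cv where Cuv: "Cu \<in> \<C>" "Cv \<in> \<C>" "u \<in> Cu" "v \<in> Cv" "Cu \<noteq> Cv" "\<C> - \<D> = {Cu, Cv}"
  proof -
    obtain T where T: "T \<subseteq> \<C> - \<D>" "card T = 2"
      using two by (meson obtain_subset_with_card_n)
    then obtain P Q where PQ: "T = {P, Q}" "P \<noteq> Q" by (metis card_2_iff)
    have PQ': "P \<in> \<C>" "Q \<in> \<C>" "u \<in> P \<or> v \<in> P" "u \<in> Q \<or> v \<in> Q"
      using T PQ unfolding \<D>_def by auto
    then have "(u \<in> P \<and> v \<in> Q) \<or> (u \<in> Q \<and> v \<in> P)" using F(7) PQ(2) by blast
    moreover have "\<C> - \<D> = {P, Q}"
    proof
      show "{P, Q} \<subseteq> \<C> - \<D>" using T PQ by blast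
      show "\<C> - \<D> \<subseteq> {P, Q}"
        using F(7) PQ' calculation unfolding \<D>_def by blast
    qed
    ultimately show ?thesis using that[of P Q] that[of Q P] PQ' PQ by blast
  qed
  have "card (\<C> - \<D>) = 2" using Cuv by simp
  then have cardD: "card \<D> = card S0" using D cD big by linarith
  have XS: "X \<inter> S0 = {}" using F(1) unfolding W_def by blast
  have C_eq: "insert Cu (insert Cv \<D>) = \<C>" using Cuv unfolding \<D>_def by blast
  have finX: "finite X" "finite S0" using X F(1) finW finV finite_subset by blast+
  show ?thesis
  proof (rule that[of "S0 \<union> X" \<D> Cu Cv])
    show "S0 \<union> X \<subseteq> V" using F(1) X unfolding W_def by blast
    show "card (S0 \<union> X) = card \<D> + k"
      using XS cardD X finX by (subst card_Un_disjoint) auto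
    show "Cu \<subseteq> V - (S0 \<union> X)" "Cv \<subseteq> V - (S0 \<union> X)"
      using F(3)[OF Cuv(1)] F(3)[OF Cuv(2)] unfolding W_def by auto
    show "C \<noteq> {} \<and> C \<subseteq> V - (S0 \<union> X)" if "C \<in> \<D>" for C
      using F(3,5)[of C] that unfolding W_def \<D>_def by auto
    show "pairwise disjnt (insert Cu (insert Cv \<D>))" using C_eq F(2) by simp
    show "{x, y} = {u, v} \<or> y \<in> C \<union> (S0 \<union> X)"
      if "C \<in> insert Cu (insert Cv \<D>)" "x \<in> C" "y \<in> nbrs E x" for C x y
      using F(6)[of C x y] that C_eq nbrs_simple_graph(2)[OF G that(3)]
      unfolding W_def nbrs_def by blast
  qed (use Cuv finD \<D>_def in auto)
qed

text \<open>The number of odd sets avoiding both ends decides the alternative. Zero gives the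
  bridge; one leaves \<open>S\<close> with \<open>k + 1\<close> vertices, and then claw-freeness
  shrinks \<open>Cu\<close> and \<open>Cv\<close> to single vertices; more is impossible by
  counting.\<close>

lemma minimal_factor_critical_edge:
  assumes G: "simple_graph V E" and cf: "claw_free V E" and mfc: "minimal_factor_critical k V E"
    and conn: "k_connected (k + 1) V E" and "k \<ge> 2" and uv: "v \<in> nbrs E u"
    and deg: "k + 2 \<le> card (nbrs E u)" "k + 2 \<le> card (nbrs E v)"
  shows "(\<exists>A S B. bridge_separation V E k u v A S B) \<or> twin_edge E u v"
proof (rule minimal_factor_critical_edge_family[OF G mfc uv])
  fix S \<D> Cu Cv
  assume S: "S \<subseteq> V" "card S = card \<D> + k" and finD: "finite \<D>"
    and Cu: "Cu \<subseteq> V - S" "u \<in> Cu" "Cu \<notin> \<D>" and Cv: "Cv \<subseteq> V - S" "v \<in> Cv" "Cv \<notin> \<D>"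
    and neq: "Cu \<noteq> Cv" and disj: "pairwise disjnt (insert Cu (insert Cv \<D>))"
    and D: "\<And>C. C \<in> \<D> \<Longrightarrow> C \<noteq> {} \<and> C \<subseteq> V - S"
    and closed: "\<And>C x y. C \<in> insert Cu (insert Cv \<D>) \<Longrightarrow> x \<in> C \<Longrightarrow> y \<in> nbrs E x \<Longrightarrow>
      {x, y} = {u, v} \<or> y \<in> C \<union> S"
  have disjuv: "Cu \<inter> Cv = {}"
    using pairwiseD[OF disj, of Cu Cv] neq by (simp add: disjnt_def)
  have disjD: "C \<inter> Cu = {} \<and> C \<inter> Cv = {}" if "C \<in> \<D>" for C
  proof -
    have "C \<noteq> Cu" "C \<noteq> Cv" using that Cu(3) Cv(3) by metis+
    then show ?thesis
      using pairwiseD[OF disj, of C Cu] pairwiseD[OF disj, of C Cv] that by (simp add: disjnt_def)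
  qed
  have closedu: "y \<in> Cu \<union> S \<or> x = u \<and> y = v" if "x \<in> Cu" "y \<in> nbrs E x" for x y
    using closed[of Cu x y] that disjuv Cv(2) by (auto simp: doubleton_eq_iff)
  have closedv: "y \<in> Cv \<union> S \<or> x = v \<and> y = u" if "x \<in> Cv" "y \<in> nbrs E x" for x y
    using closed[of Cv x y] that disjuv Cu(2) by (auto simp: doubleton_eq_iff)
  have closedD: "y \<in> C \<union> S" if "C \<in> \<D>" "x \<in> C" "y \<in> nbrs E x" for C x y
    using closed[of C x y] that disjD[OF that(1)] Cu(2) Cv(2) by (auto simp: doubleton_eq_iff)
  have finV: "finite V" using G unfolding simple_graph_def by blast
  have finS: "finite S" using S finV finite_subset by blast
  show ?thesis
  proof (cases "\<D> = {}")
    case True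
    \<comment> \<open>The second side takes in \<open>Cv\<close> and all vertices outside both odd
      sets.\<close>
    have "bridge_separation V E k u v Cu S (V - S - Cu)"
      unfolding bridge_separation_def
    proof (intro conjI ballI impI)
      fix x y assume "x \<in> Cu" "y \<in> V - S - Cu" "y \<in> nbrs E x"
      then show "x = u" "y = v" using closedu[of x y] by auto
    qed (use S True Cu Cv disjuv in auto)
    then show ?thesis by blast
  next
    case False
    \<comment> \<open>In \<open>G\<close> the edge \<open>uv\<close> joins \<open>Cu\<close> and
      \<open>Cv\<close>, so only their union has its boundary in \<open>S\<close>.\<close>
    let ?\<P> = "insert (Cu \<union> Cv) \<D>"
    have notin: "Cu \<union> Cv \<notin> \<D>" using disjD Cu by blast
    have P2: "card ?\<P> = Suc (card \<D>)" "card ?\<P> \<ge> 2"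
      using notin finD False by (simp_all add: Suc_leI card_gt_0_iff)
    have disjP: "pairwise disjnt ?\<P>"
      using disj disjD by (auto simp: pairwise_insert disjnt_def)
    have closedP: "y \<in> P \<union> S" if "P \<in> ?\<P>" "x \<in> P" "y \<in> nbrs E x" for P x y
      using closedu[of x y] closedv[of x y] closedD[of P x y] that Cu(2) Cv(2) by auto
    note inc = claw_free_incidence_bound[OF G cf conn S(1) _ P2(2) disjP _ closedP]
    have "(k + 1) * card ?\<P> \<le> 2 * card S"
      by (rule inc(2)) (use finD D Cu Cv in auto)
    then have bound: "(k + 1) * Suc (card \<D>) \<le> 2 * (card \<D> + k)" using P2 S by simp
    \<comment> \<open>With \<open>d = card \<D>\<close> the bound reads
      \<open>(k - 1) * (d - 1) \<le> 0\<close>, which forces \<open>d \<le> 1\<close> as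
      \<open>k \<ge> 2\<close>.\<close>
    have "card \<D> = 1"
    proof (rule ccontr)
      assume "card \<D> \<noteq> 1"
      moreover have "card \<D> \<noteq> 0" using False finD by simp
      ultimately obtain j where j: "card \<D> = j + 2" using nat_le_iff_add[of 2 "card \<D>"] by force
      obtain i where "k = i + 2" using \<open>k \<ge> 2\<close> nat_le_iff_add[of 2 k] by force
      then show False using bound j by (simp add: algebra_simps)
    qed
    then obtain Cw where Cw: "\<D> = {Cw}" by (metis card_1_singletonE)
    have cardS: "card S = k + 1" using S \<open>card \<D> = 1\<close> by simp
    have "k + 1 \<le> card {s \<in> S. \<exists>x\<in>Cw. s \<in> nbrs E x}"
      by (rule inc(1)) (use finD D Cu Cv Cw in auto)
    then have Sw: "{s \<in> S. \<exists>x\<in>Cw. s \<in> nbrs E x} = S"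
      using finS cardS by (intro card_seteq) auto
    \<comment> \<open>Each \<open>s\<close> in \<open>S\<close> also has a neighbour in
      \<open>Cw\<close>. Neighbours of \<open>s\<close> in all three odd sets would form a claw
      unless those in \<open>Cu\<close> and \<open>Cv\<close> are adjacent, and \<open>uv\<close> is
      the only edge there.\<close>
    have only_uv: "x = u \<and> y = v"
      if "s \<in> S" "x \<in> Cu" "s \<in> nbrs E x" "y \<in> Cv" "s \<in> nbrs E y" for s x y
    proof -
      obtain z where z: "z \<in> Cw" "s \<in> nbrs E z" using Sw \<open>s \<in> S\<close> by blast
      have "x \<noteq> y" "x \<noteq> z" "y \<noteq> z" using disjuv disjD Cw that z by blast+
      then have "y \<in> nbrs E x \<or> x \<in> nbrs E z \<or> y \<in> nbrs E z"
        using claw_freeD[OF G cf, of x s y z] that z nbrs_sym[of _ E] by blast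
      moreover have "x \<notin> nbrs E z" "y \<notin> nbrs E z"
        using closedD[of Cw z] Cw z disjD[of Cw] that Cu Cv by blast+
      ultimately have "y \<in> nbrs E x" by blast
      then show ?thesis using closedu[of x y] that disjuv Cv(1) by blast
    qed
    have overlap: "A \<inter> B \<noteq> {}" if "A \<subseteq> S" "B \<subseteq> S" "k \<le> card A" "k \<le> card B" for A B
    proof
      assume "A \<inter> B = {}"
      then have "card A + card B = card (A \<union> B)"
        using that finS by (metis card_Un_disjoint finite_subset)
      also have "\<dots> \<le> k + 1" using that finS cardS card_mono[of S "A \<union> B"] by simp
      finally show False using that \<open>k \<ge> 2\<close> by simp
    qed
    have uV: "u \<in> V" "u \<notin> Cv" "u \<notin> S" "v \<in> V" "v \<notin> Cu" "v \<notin> S"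
      using Cu Cv disjuv by blast+
    have CV: "Cu \<subseteq> V" "Cu \<inter> S = {}" "Cv \<subseteq> V" "Cv \<inter> S = {}"
      using Cu(1) Cv(1) by blast+
    have Nu: "k \<le> card {s \<in> S. \<exists>x\<in>Cu. s \<in> nbrs E x}"
      by (rule card_boundary_with_vertex[OF G conn CV(1) Cu(2) S(1) CV(2) closedu uV(4-6)])
        (use deg in simp_all)
    have Nv: "k \<le> card {s \<in> S. \<exists>x\<in>Cv. s \<in> nbrs E x}"
      by (rule card_boundary_with_vertex[OF G conn CV(3) Cv(2) S(1) CV(4) closedv uV(1-3)])
        (use deg in simp_all)
    \<comment> \<open>Otherwise \<open>Cu - {u}\<close> and \<open>Cv\<close> each see
      \<open>k\<close> of the \<open>k + 1\<close> vertices of \<open>S\<close>. They share one of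
      these because \<open>2 * k > k + 1\<close>, which contradicts \<open>only_uv\<close>.\<close>
    have "Cu = {u}"
    proof (rule ccontr)
      assume "Cu \<noteq> {u}"
      then have "k \<le> card {s \<in> S. \<exists>x\<in>Cu - {u}. s \<in> nbrs E x}"
        using closedu
        by (intro card_boundary_minus_vertex[OF G conn CV(1) Cu(2) _ S(1) CV(2) _ uV(4-6)]) blast+
      then have "{s \<in> S. \<exists>x\<in>Cu - {u}. s \<in> nbrs E x} \<inter> {s \<in> S. \<exists>x\<in>Cv. s \<in> nbrs E x} \<noteq> {}"
        using Nv by (intro overlap) auto
      then show False using only_uv by blast
    qed
    have "Cv = {v}"
    proof (rule ccontr)
      assume "Cv \<noteq> {v}"
      then have "k \<le> card {s \<in> S. \<exists>x\<in>Cv - {v}. s \<in> nbrs E x}"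
        using closedv
        by (intro card_boundary_minus_vertex[OF G conn CV(3) Cv(2) _ S(1) CV(4) _ uV(1-3)]) blast+
      then have "{s \<in> S. \<exists>x\<in>Cv - {v}. s \<in> nbrs E x} \<inter> {s \<in> S. \<exists>x\<in>Cu. s \<in> nbrs E x} \<noteq> {}"
        using Nu by (intro overlap) auto
      then show False using only_uv by blast
    qed
    \<comment> \<open>Here the degree bound meets the size \<open>k + 2\<close> of the set that
      contains the neighbourhood.\<close>
    have full: "nbrs E c = insert d S"
      if "nbrs E c \<subseteq> insert d S" "k + 2 \<le> card (nbrs E c)" "d \<notin> S" for c d
      using that finS cardS by (intro card_seteq) auto
    have "nbrs E u \<subseteq> insert v S"
      using closedu[of u] \<open>Cu = {u}\<close> nbrs_simple_graph(3)[OF G, of u u] by auto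
    then have Nu: "nbrs E u = insert v S" using full deg uV by blast
    have "nbrs E v \<subseteq> insert u S"
      using closedv[of v] \<open>Cv = {v}\<close> nbrs_simple_graph(3)[OF G, of v v] by auto
    then have Nv: "nbrs E v = insert u S" using full deg uV by blast
    have "\<exists>z\<in>nbrs E s. z \<noteq> u \<and> z \<notin> nbrs E u" if "s \<in> S" for s
    proof -
      obtain z where z: "z \<in> Cw" "s \<in> nbrs E z" using Sw \<open>s \<in> S\<close> by blast
      moreover have "z \<noteq> u" "z \<notin> nbrs E u"
        using z D[of Cw] disjD[of Cw] Cw Cu Cv unfolding Nu by blast+
      ultimately show ?thesis using nbrs_sym[of s E z] by blast
    qed
    then have "twin_edge E u v" unfolding twin_edge_def Nu Nv using uV by auto
    then show ?thesis ..
  qed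
qed

text \<open>The third vertex excludes twin edges, because its edge to an end of the twin edge is
  itself a bridge or a twin edge. Three bridges remain, and uncrossing excludes them.\<close>

lemma minimal_factor_critical_no_triangle:
  assumes G: "simple_graph V E" and cf: "claw_free V E" and mfc: "minimal_factor_critical k V E"
    and conn: "k_connected (k + 1) V E" and "k \<ge> 2"
    and adj: "v \<in> nbrs E u" "w \<in> nbrs E v" "w \<in> nbrs E u"
    and deg: "k + 2 \<le> card (nbrs E u)" "k + 2 \<le> card (nbrs E v)" "k + 2 \<le> card (nbrs E w)"
  shows False
proof -
  note edge = minimal_factor_critical_edge[OF G cf mfc conn \<open>k \<ge> 2\<close>]
  have no_twin: "\<not> twin_edge E x y"
    if "y \<in> nbrs E x" "z \<in> nbrs E x" "z \<in> nbrs E y"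
      "k + 2 \<le> card (nbrs E x)" "k + 2 \<le> card (nbrs E z)" for x y z
    using twin_edge_no_triangle[OF G conn, of x y z] edge[of z x] that
      nbrs_simple_graph(3)[OF G that(3)] by blast
  note adj' = adj adj[THEN nbrs_sym[THEN iffD1]]
  have "\<not> twin_edge E u v" "\<not> twin_edge E v w" "\<not> twin_edge E w u"
    using no_twin[of v u w] no_twin[of w v u] no_twin[of u w v] adj' deg by blast+
  then obtain A S B A' S' B' A'' S'' B'' where "bridge_separation V E k u v A S B"
    "bridge_separation V E k v w A' S' B'" "bridge_separation V E k w u A'' S'' B''"
    using edge[of v u] edge[of w v] edge[of u w] adj' deg by blast
  then show False using bridge_separation_no_triangle[OF G conn adj deg] by blast
qed

section \<open>Counting the edges between big vertices and vertices of degree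
  \<open>k + 1\<close>\<close>

theorem theorem1p5:
  fixes V :: "'a set" and E :: "'a set set" and k :: nat
  assumes "k \<ge> 1"
    and "simple_graph V E"
    and "claw_free V E"
    and "minimal_factor_critical k V E"
    and "k_connected (k + 1) V E"
  shows "real (card {v \<in> V. degree E v = k + 1}) \<ge> (real k - 1) / (2 * real k) * real (card V)"
proof (cases "k = 1")
  \<comment> \<open>For \<open>k = 1\<close> the claimed lower bound is zero.\<close>
  case False
  then have "k \<ge> 2" using assms(1) by simp
  note G = assms(2) and cf = assms(3) and mfc = assms(4) and conn = assms(5)
  define D F where "D = {v \<in> V. degree E v = k + 1}" and "F = {v \<in> V. degree E v \<noteq> k + 1}"
  have finV: "finite V" using G unfolding simple_graph_def by blast
  have fin: "finite D" "finite F" and V: "V = D \<union> F" "D \<inter> F = {}"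
    using finV unfolding D_def F_def by auto
  \<comment> \<open>Connectivity makes \<open>k + 1\<close> the least possible degree, so every
    other degree is at least \<open>k + 2\<close>.\<close>
  have degF: "k + 2 \<le> card (nbrs E v)" if "v \<in> F" for v
    using that k_connected_card_nbrs[OF G conn, of v] degree_eq_card_nbrs[OF G, of v]
    unfolding F_def by auto
  \<comment> \<open>Two adjacent big neighbours of \<open>v\<close> would form a big triangle with
    it, so three big neighbours would be pairwise nonadjacent and form a claw at
    \<open>v\<close>.\<close>
  have F2: "card {w \<in> F. w \<in> nbrs E v} \<le> 2" if v: "v \<in> F" for v
  proof (rule ccontr)
    assume "\<not> ?thesis"
    then have "3 \<le> card {w \<in> F. w \<in> nbrs E v}" by simp
    then obtain T where T: "T \<subseteq> {w \<in> F. w \<in> nbrs E v}" "card T = 3"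
      by (meson obtain_subset_with_card_n)
    then obtain a b c where abc: "T = {a, b, c}" "a \<noteq> b" "a \<noteq> c" "b \<noteq> c"
      by (metis card_3_iff)
    then have mem: "{a, b, c} \<subseteq> F" "{a, b, c} \<subseteq> nbrs E v" using T by auto
    have "y \<notin> nbrs E x" if "x \<in> {a, b, c}" "y \<in> {a, b, c}" for x y
      using minimal_factor_critical_no_triangle[OF G cf mfc conn \<open>k \<ge> 2\<close>, of x v y]
        degF v mem that by blast
    then show False
      using claw_freeD[OF G cf, of a v b c] abc mem by blast
  qed
  have "k \<le> card {w \<in> D. w \<in> nbrs E v}" if v: "v \<in> F" for v
  proof -
    have "nbrs E v = {w \<in> D. w \<in> nbrs E v} \<union> {w \<in> F. w \<in> nbrs E v}"
      using nbrs_simple_graph(2)[OF G] V by blast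
    then have "card (nbrs E v) \<le> card {w \<in> D. w \<in> nbrs E v} + card {w \<in> F. w \<in> nbrs E v}"
      by (metis card_Un_le)
    then show ?thesis using degF[OF v] F2[OF v] by linarith
  qed
  then have "(\<Sum>v\<in>F. k) \<le> (\<Sum>v\<in>F. card {w \<in> D. w \<in> nbrs E v})"
    by (rule sum_mono)
  also have "\<dots> = (\<Sum>w\<in>D. card {v \<in> F. w \<in> nbrs E v})"
    by (rule sum_multicount_gen) (use fin in auto)
  also have "\<dots> \<le> (\<Sum>w\<in>D. k + 1)"
  proof (rule sum_mono)
    fix w assume "w \<in> D"
    then have "card (nbrs E w) = k + 1"
      using degree_eq_card_nbrs[OF G, of w] unfolding D_def by simp
    moreover have "{v \<in> F. w \<in> nbrs E v} \<subseteq> nbrs E w" using nbrs_sym[of w E] by blast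
    ultimately show "card {v \<in> F. w \<in> nbrs E v} \<le> k + 1"
      using card_mono[OF finite_nbrs[OF G]] by metis
  qed
  finally have "card F * k \<le> card D * (k + 1)" by simp
  then have "real (card F) * real k \<le> real (card D) * (real k + 1)"
    by (metis of_nat_1 of_nat_add of_nat_le_iff of_nat_mult)
  \<comment> \<open>Adding \<open>(k - 1) * card D\<close> to both sides suffices, since
    \<open>(k - 1) * card F \<le> k * card F\<close>.\<close>
  then have "(real k - 1) * (real (card D) + real (card F)) \<le> 2 * real k * real (card D)"
    by (simp add: algebra_simps)
  moreover have "card V = card D + card F" using V fin card_Un_disjoint by metis
  ultimately show ?thesis
    using \<open>k \<ge> 2\<close> unfolding D_def[symmetric] by (simp add: divide_simps mult.commute)
qed simp

end
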